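(* Let $1 < p < \infty$ be fixed, and suppose there is a fixed constant $c > 0$ such that $1 \le \varepsilon^{-1} \le n^{(1-c)/p}$. Then there exists a randomized linear sketch of dimension $O(\varepsilon^{-1} n^{1-1/p})$ such that for every nonnegative vector $x \in \mathbb{R}_{\ge 0}^n$, the output estimate $\hat{x}$ never underestimates any $x_i$ (i.e., $\hat{x}_i \ge x_i$ for all $i$ always), and with probability at least $1 - 1/n$, $\hat{x}_i \le x_i + \varepsilon \|x\|_p$ for all $i \in [n]$.
   Context: A linear sketch of dimension $k$ on $\mathbb{R}^n$ consists of a random matrix $A \in \mathbb{R}^{k\times n}$ (with distribution independent of the input) together with a recovery procedure that outputs an estimate $\hat{x}$ from $A$ and $Ax$ only. The constant in the $O(\cdot)$ may depend on the fixed $p$ and $c$. $\|x\|_p = (\sum_i |x_i|^p)^{1/p}$. *)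

theory Defs
  imports "HOL-Probability.Probability" "Jordan_Normal_Form.Matrix"
begin

no_notation Finite_Cartesian_Product.vec_nth (infixl "$" 90)

definition lp_norm :: "real \<Rightarrow> real vec \<Rightarrow> real" where
  "lp_norm p x = (\<Sum>i<dim_vec x. \<bar>x $ i\<bar> powr p) powr (1 / p)"

(* A random k x n matrix is given by its law M: a probability measure whose space consists of
   the matrices that can be drawn, on a sigma-algebra that makes every entry a random variable.
   The space may be a proper subset of carrier_mat k n, so that a property holding "always"
   is one holding for every matrix in the space. An arbitrary random matrix on an arbitrary
   probability space is covered, by pushing the measure forward to the range of the matrix. *)
definition random_matrix :: "nat \<Rightarrow> nat \<Rightarrow> real mat measure \<Rightarrow> bool" where
  "random_matrix k n M \<longleftrightarrow>
     prob_space M \<and> space M \<subseteq> carrier_mat k n \<and>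
     (\<forall>i<k. \<forall>j<n. (\<lambda>A. A $$ (i, j)) \<in> borel_measurable M)"

(* The recovery procedure R sees only the matrix A and the sketch A x. *)
definition estimate :: "(real mat \<Rightarrow> real vec \<Rightarrow> real vec) \<Rightarrow> real mat \<Rightarrow> real vec \<Rightarrow> real vec" where
  "estimate R A x = R A (A *\<^sub>v x)"

(* The last conjunct says that the estimate of each fixed input is a random vector, so that
   events about it have a probability. *)
definition linear_sketch ::
  "nat \<Rightarrow> nat \<Rightarrow> real mat measure \<Rightarrow> (real mat \<Rightarrow> real vec \<Rightarrow> real vec) \<Rightarrow> bool" where
  "linear_sketch k n M R \<longleftrightarrow>
     random_matrix k n M \<and>
     (\<forall>A \<in> carrier_mat k n. \<forall>y \<in> carrier_vec k. R A y \<in> carrier_vec n) \<and>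
     (\<forall>x \<in> carrier_vec n. \<forall>i<n. (\<lambda>A. estimate R A x $ i) \<in> borel_measurable M)"

end

(* The sketch is Count-Min with a constant number d of rows, each hashing [n] uniformly into
   B of order n^(1-1/p)/eps buckets; the estimate of a coordinate is the least of its d buckets.
   Fix i, put L = |x|_p, and call x_j heavy if x_j > eps L. At most eps^(-p) coordinates are
   heavy, so one of them meets i in a given row with probability at most eps^(-p)/B. The light
   coordinates contribute mean at most eps L / 2 by the power mean inequality, and Chebyshev
   bounds the deviation, since their squares sum to at most L^2 (eps^(2-p) + n^(1-2/p)).
   As 1/eps <= n^((1-c)/p), both failure probabilities are at most a constant times n^(-delta)
   with delta = c min(1-1/p, 1/p), so d >= 2/delta independent rows all fail with probability
   at most n^(-2), and a union bound over i finishes the proof. *)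

theory Submission
  imports Defs
begin

section \<open>Counting hash functions with prescribed collisions\<close>

text \<open>Extensional functions form a finite set, so a probability over a uniform hash function
  is a cardinality divided by \<open>B ^ n\<close>. The whole tail analysis is done by counting in
  this unnormalised form.\<close>

definition hash_functions :: "nat \<Rightarrow> nat \<Rightarrow> (nat \<Rightarrow> nat) set" where
  "hash_functions n B = {..<n} \<rightarrow>\<^sub>E {..<B}"

lemma finite_hash_functions [simp]: "finite (hash_functions n B)"
  by (simp add: hash_functions_def finite_PiE)

lemma card_hash_functions: "card (hash_functions n B) = B ^ n"
  by (simp add: hash_functions_def card_PiE)

text \<open>The powers of \<open>B\<close> are placed so that no truncated subtraction occurs.\<close>

lemma card_hash_agree:
  assumes S: "S \<subseteq> {..<n}" and i: "i \<in> S"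
  shows "card {h \<in> hash_functions n B. \<forall>t\<in>S. h t = h i} * B ^ card S = B * B ^ n"
proof -
  \<comment> \<open>The functions constant on \<open>S\<close> are classified by their common value
    \<open>b\<close>. The classes are disjoint because \<open>h i\<close> recovers
    \<open>b\<close>.\<close>
  define P where "P b = PiE {..<n} (\<lambda>t. if t \<in> S then {b} else {..<B})" for b
  have eq: "{h \<in> hash_functions n B. \<forall>t\<in>S. h t = h i} = (\<Union>b<B. P b)"
  proof (intro Set.set_eqI iffI)
    fix h assume h: "h \<in> {h \<in> hash_functions n B. \<forall>t\<in>S. h t = h i}"
    then have F: "h \<in> {..<n} \<rightarrow>\<^sub>E {..<B}" unfolding hash_functions_def by blast
    then have "h i < B" using S i by (auto simp: PiE_iff)
    moreover have "h t \<in> (if t \<in> S then {h i} else {..<B})" if "t < n" for t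
    proof (cases "t \<in> S")
      case True
      then have "h t = h i" using h by blast
      then show ?thesis using True by simp
    qed (use F that in \<open>simp add: PiE_iff\<close>)
    then have "h \<in> P (h i)" unfolding P_def PiE_iff using F by (simp add: PiE_iff)
    ultimately show "h \<in> (\<Union>b<B. P b)" by auto
  next
    fix h assume "h \<in> (\<Union>b<B. P b)"
    then obtain b where b: "b < B" "h \<in> P b" by auto
    have "h t = b" if "t \<in> S" for t
      using PiE_mem[OF b(2)[unfolded P_def], of t] that S by auto
    then have "\<forall>t\<in>S. h t = h i" using i by simp
    moreover have "h \<in> hash_functions n B"
      using b by (auto simp: P_def hash_functions_def PiE_iff split: if_splits)
    ultimately show "h \<in> {h \<in> hash_functions n B. \<forall>t\<in>S. h t = h i}" by blast
  qed
  have fin: "finite (P b)" for b by (auto simp: P_def intro!: finite_PiE)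
  have cardP: "card (P b) = B ^ (n - card S)" for b
  proof -
    have "card (P b) = (\<Prod>t<n. if t \<in> S then 1 else B)"
      unfolding P_def by (subst card_PiE) (auto intro!: prod.cong)
    also have "\<dots> = B ^ card ({..<n} - S)"
      by (simp add: prod.If_cases Diff_eq)
    also have "card ({..<n} - S) = n - card S"
      using S by (simp add: card_Diff_subset finite_subset)
    finally show ?thesis .
  qed
  have hi: "h i = b" if "h \<in> P b" for h b
    using PiE_mem[OF that[unfolded P_def], of i] S i by auto
  have "card (\<Union>b<B. P b) = (\<Sum>b<B. card (P b))"
    by (rule card_UN_disjoint) (use fin hi in blast)+
  then have "card {h \<in> hash_functions n B. \<forall>t\<in>S. h t = h i} = B * B ^ (n - card S)"
    by (simp add: eq cardP)
  moreover have "card S \<le> n" using S card_mono[of "{..<n}" S] by simp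
  ultimately show ?thesis by (simp add: mult.assoc flip: power_add)
qed

lemma card_hash_collision:
  assumes "i < n" "j < n" "i \<noteq> j" "B > 0"
  shows "real (card {h \<in> hash_functions n B. h j = h i}) = real B ^ n / real B"
proof -
  have "card {h \<in> hash_functions n B. h j = h i} * (B * B) = B * B ^ n"
    using card_hash_agree[of "{i, j}" n i B] assms by (simp add: power2_eq_square)
  from arg_cong[OF this, of real]
  have "real (card {h \<in> hash_functions n B. h j = h i}) * (B * B) = B * real B ^ n"
    by simp
  then show ?thesis using assms by (simp add: field_simps)
qed

text \<open>The fraction is the product of the two single collision probabilities. Collisions of
  distinct \<open>j\<close> and \<open>k\<close> with the same \<open>i\<close> are thus
  independent, which makes the covariances vanish.\<close>

lemma card_hash_collision2:
  assumes "i < n" "j < n" "k < n" "i \<noteq> j" "i \<noteq> k" "j \<noteq> k" "B > 0"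
  shows "real (card {h \<in> hash_functions n B. h j = h i \<and> h k = h i}) = real B ^ n / (real B)\<^sup>2"
proof -
  have "card {h \<in> hash_functions n B. h j = h i \<and> h k = h i} * (B * (B * B)) = B * B ^ n"
    using card_hash_agree[of "{i, j, k}" n i B] assms by (simp add: power3_eq_cube mult.assoc)
  from arg_cong[OF this, of real]
  have "real (card {h \<in> hash_functions n B. h j = h i \<and> h k = h i}) * (B * (B * B)) = B * real B ^ n"
    by simp
  then show ?thesis using assms by (simp add: field_simps power2_eq_square)
qed

section \<open>Second moment and Chebyshev bound for the colliding mass\<close>

lemma sum_of_bool_card:
  assumes "finite A"
  shows "(\<Sum>h\<in>A. of_bool (P h) :: real) = card {h \<in> A. P h}"
  using assms by (simp add: Int_def)

text \<open>Collision indicators have mean \<open>1 / B\<close>. For distinct \<open>j\<close> and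
  \<open>k\<close> independence gives covariance 0; for \<open>j = k\<close> the variance
  \<open>1 / B - 1 / B^2\<close> is bounded by \<open>1 / B\<close>.\<close>

lemma hash_covariance:
  assumes i: "i < n" and j: "j < n" "j \<noteq> i" and k: "k < n" "k \<noteq> i" and B: "B > 0"
  shows "(\<Sum>h\<in>hash_functions n B. (of_bool (h j = h i) - 1 / real B) * (of_bool (h k = h i) - 1 / real B))
         \<le> (if j = k then real B ^ n / real B else 0)"
proof -
  let ?F = "hash_functions n B"
  let ?N = "\<lambda>P. real (card {h \<in> ?F. P h})"
  have "(\<Sum>h\<in>?F. (of_bool (h j = h i) - 1 / real B) * (of_bool (h k = h i) - 1 / real B))
     = (\<Sum>h\<in>?F. of_bool (h j = h i \<and> h k = h i) - of_bool (h j = h i) / B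
            - of_bool (h k = h i) / B + 1 / (real B)\<^sup>2)"
    by (intro sum.cong refl) (simp add: algebra_simps power2_eq_square of_bool_conj)
  also have "\<dots> = ?N (\<lambda>h. h j = h i \<and> h k = h i) - ?N (\<lambda>h. h j = h i) / B
            - ?N (\<lambda>h. h k = h i) / B + real B ^ n / (real B)\<^sup>2"
    by (simp only: sum.distrib sum_subtractf sum_of_bool_card[OF finite_hash_functions]
          flip: sum_divide_distrib) (simp add: card_hash_functions)
  also have "\<dots> \<le> (if j = k then real B ^ n / real B else 0)"
    using assms by (auto simp: card_hash_collision card_hash_collision2 power2_eq_square)
  finally show ?thesis .
qed

text \<open>Expanding the square leaves covariances weighted by \<open>x j * x k\<close>.
  Nonnegativity of the weights preserves their upper bounds, and only the diagonal survives.\<close>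

lemma hash_second_moment:
  assumes i: "i < n" and J: "J \<subseteq> {..<n} - {i}" and B: "B > 0" and x: "\<And>j. j \<in> J \<Longrightarrow> 0 \<le> x j"
  shows "(\<Sum>h\<in>hash_functions n B. (\<Sum>j\<in>J. x j * (of_bool (h j = h i) - 1 / real B))\<^sup>2)
         \<le> real B ^ n / real B * (\<Sum>j\<in>J. (x j)\<^sup>2)"
proof -
  let ?F = "hash_functions n B"
  let ?X = "\<lambda>h j. of_bool (h j = h i) - 1 / real B"
  have fin: "finite J" using J finite_subset by blast
  have "(\<Sum>h\<in>?F. (\<Sum>j\<in>J. x j * ?X h j)\<^sup>2)
      = (\<Sum>h\<in>?F. \<Sum>j\<in>J. \<Sum>k\<in>J. (x j * x k) * (?X h j * ?X h k))"
    by (simp add: power2_eq_square sum_product mult_ac)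
  also have "\<dots> = (\<Sum>j\<in>J. \<Sum>h\<in>?F. \<Sum>k\<in>J. (x j * x k) * (?X h j * ?X h k))"
    by (rule sum.swap)
  also have "\<dots> = (\<Sum>j\<in>J. \<Sum>k\<in>J. (x j * x k) * (\<Sum>h\<in>?F. ?X h j * ?X h k))"
    unfolding sum_distrib_left by (intro sum.cong refl sum.swap)
  also have "\<dots> \<le> (\<Sum>j\<in>J. \<Sum>k\<in>J. (x j * x k) * (if j = k then real B ^ n / real B else 0))"
  proof (intro sum_mono mult_left_mono)
    fix j k assume "j \<in> J" "k \<in> J"
    then show "(\<Sum>h\<in>?F. ?X h j * ?X h k) \<le> (if j = k then real B ^ n / real B else 0)"
      using J by (intro hash_covariance i B) auto
  qed (use x in simp)
  also have "\<dots> = (\<Sum>j\<in>J. (x j * x j) * (real B ^ n / real B))"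
    using fin by (simp add: sum.delta' if_distrib[where f = "\<lambda>a. _ * a"] cong: if_cong)
  also have "\<dots> = real B ^ n / real B * (\<Sum>j\<in>J. (x j)\<^sup>2)"
    by (simp add: sum_distrib_left power2_eq_square mult_ac)
  finally show ?thesis .
qed

text \<open>The mean uses up at most half of the threshold, so exceeding \<open>t\<close> forces a
  deviation above \<open>t / 2\<close>. Squaring this half produces the factor 4.\<close>

lemma hash_chebyshev:
  assumes i: "i < n" and J: "J \<subseteq> {..<n} - {i}" and B: "B > 0" and x: "\<And>j. j \<in> J \<Longrightarrow> 0 \<le> x j"
    and t: "t > 0" and mean: "(\<Sum>j\<in>J. x j) / B \<le> t / 2"
  shows "real (card {h \<in> hash_functions n B. t < (\<Sum>j\<in>J. x j * of_bool (h j = h i))})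
         \<le> real B ^ n * (4 * (\<Sum>j\<in>J. (x j)\<^sup>2) / (B * t\<^sup>2))"
proof -
  let ?F = "hash_functions n B"
  let ?Z = "\<lambda>h. \<Sum>j\<in>J. x j * (of_bool (h j = h i) - 1 / real B)"
  let ?T = "{h \<in> ?F. t < (\<Sum>j\<in>J. x j * of_bool (h j = h i))}"
  have "real (card ?T) * (t / 2)\<^sup>2 = (\<Sum>h\<in>?T. (t / 2)\<^sup>2)" by simp
  also have "\<dots> \<le> (\<Sum>h\<in>?T. (?Z h)\<^sup>2)"
  proof (intro sum_mono power_mono)
    fix h assume "h \<in> ?T"
    moreover have "?Z h = (\<Sum>j\<in>J. x j * of_bool (h j = h i)) - (\<Sum>j\<in>J. x j) / B"
      by (simp add: right_diff_distrib sum_subtractf sum_divide_distrib)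
    ultimately show "t / 2 \<le> ?Z h" using mean by simp
  qed (use t in simp)
  also have "\<dots> \<le> (\<Sum>h\<in>?F. (?Z h)\<^sup>2)"
    by (intro sum_mono2) auto
  also have "\<dots> \<le> real B ^ n / real B * (\<Sum>j\<in>J. (x j)\<^sup>2)"
    by (rule hash_second_moment) (use assms in auto)
  finally show ?thesis using t B by (simp add: field_simps power2_eq_square)
qed

section \<open>Deterministic inequalities for vectors of bounded p-norm\<close>

text \<open>Hoelder's inequality against the constant vector 1, where \<open>T\<close> bounds the
  q-norm. It serves twice: with exponent \<open>p\<close> for the mean of the light noise, and with
  exponent \<open>p / 2\<close> for the squares when \<open>p > 2\<close>.\<close>

lemma power_mean:
  fixes x :: "'a \<Rightarrow> real"
  assumes J: "finite J" "card J \<le> n" and n: "n > 0" and q: "q \<ge> 1" and T: "T > 0"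
    and x: "\<And>j. j \<in> J \<Longrightarrow> 0 \<le> x j" and le: "(\<Sum>j\<in>J. x j powr q) \<le> T powr q"
  shows "(\<Sum>j\<in>J. x j) \<le> real n powr (1 - 1 / q) * T"
\<comment> \<open>At \<open>q = 1\<close> the conjugate exponent \<open>q / (q - 1)\<close> would
  have denominator 0.\<close>
proof (cases "q = 1")
  case True
  then have "(\<Sum>j\<in>J. x j) = (\<Sum>j\<in>J. x j powr q)"
    using x by (intro sum.cong) auto
  then show ?thesis using le True T n by simp
next
  case False
  then have q1: "q > 1" using q by simp
  define r where "r = q / (q - 1)"
  have r: "r > 1" "1 / q + 1 / r = 1" using q1 by (auto simp: r_def field_simps)
  \<comment> \<open>Young's inequality is applied after normalising by the extremal constant vector.\<close>
  define u where "u = T * real n powr (- (1 / q))"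
  have u: "u > 0" using T n by (simp add: u_def)
  have uq: "u powr q = T powr q / n"
    using T n q by (simp add: u_def powr_divide powr_powr powr_minus_divide)
  then have Tu: "T powr q / u powr q = n" using T n by simp
  have "(\<Sum>j\<in>J. x j / u) \<le> (\<Sum>j\<in>J. (x j powr q / u powr q) / q + 1 / r)"
    using Youngs_inequality[OF q1 r, of "x j / u" 1 for j] x u
    by (intro sum_mono) (simp add: powr_divide)
  also have "\<dots> = (\<Sum>j\<in>J. x j powr q) / (u powr q) / q + card J / r"
    by (simp add: sum.distrib sum_divide_distrib)
  also have "\<dots> \<le> (T powr q) / (u powr q) / q + n / r"
    using le J q1 r by (intro add_mono divide_right_mono) auto
  also have "\<dots> = n * (1 / q + 1 / r)"
    unfolding Tu by (simp add: field_simps)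
  also have "\<dots> = n" using r by simp
  finally have "(\<Sum>j\<in>J. x j) \<le> n * u"
    using u by (simp add: field_simps flip: sum_divide_distrib)
  also have "\<dots> = n powr (1 - 1 / q) * T"
    using n by (simp add: u_def powr_diff powr_minus_divide)
  finally show ?thesis .
qed

text \<open>Each summand of the bound pays for one range of \<open>p\<close>. For
  \<open>p \<le> 2\<close>, write \<open>x^2 = x^p * x^(2-p)\<close> and bound the last factor by
  truncation; for \<open>p > 2\<close>, apply the power mean inequality to the squares.\<close>

lemma sum_squares_truncated:
  fixes x :: "'a \<Rightarrow> real"
  assumes J: "finite J" "card J \<le> n" and n: "n > 0" and p: "p > 1" and L: "L > 0" and e: "\<epsilon> > 0"
    and x: "\<And>j. j \<in> J \<Longrightarrow> 0 \<le> x j" and trunc: "\<And>j. j \<in> J \<Longrightarrow> x j \<le> \<epsilon> * L"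
    and le: "(\<Sum>j\<in>J. x j powr p) \<le> L powr p"
  shows "(\<Sum>j\<in>J. (x j)\<^sup>2) \<le> L\<^sup>2 * (\<epsilon> powr (2 - p) + real n powr (1 - 2 / p))"
proof (cases "p \<le> 2")
  case True
  have "(\<Sum>j\<in>J. (x j)\<^sup>2) \<le> (\<Sum>j\<in>J. x j powr p * (\<epsilon> * L) powr (2 - p))"
  proof (rule sum_mono)
    fix j assume j: "j \<in> J"
    show "(x j)\<^sup>2 \<le> x j powr p * (\<epsilon> * L) powr (2 - p)"
    proof (cases "x j = 0")
      case False
      then have pos: "x j > 0" using x[OF j] by simp
      then have "(x j)\<^sup>2 = x j powr p * x j powr (2 - p)"
        by (simp add: powr_numeral flip: powr_add)
      also have "\<dots> \<le> x j powr p * (\<epsilon> * L) powr (2 - p)"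
        using True pos trunc[OF j] by (intro mult_left_mono powr_mono2) auto
      finally show ?thesis .
    qed simp
  qed
  also have "\<dots> = (\<Sum>j\<in>J. x j powr p) * (\<epsilon> * L) powr (2 - p)"
    by (simp add: sum_distrib_right)
  also have "\<dots> \<le> L powr p * (\<epsilon> * L) powr (2 - p)"
    using le by (intro mult_right_mono) auto
  also have "\<dots> = (L powr p * L powr (2 - p)) * \<epsilon> powr (2 - p)"
    using L e by (simp add: powr_mult)
  also have "L powr p * L powr (2 - p) = L\<^sup>2"
    using L by (simp add: powr_numeral flip: powr_add)
  also have "L\<^sup>2 * \<epsilon> powr (2 - p) \<le> L\<^sup>2 * (\<epsilon> powr (2 - p) + real n powr (1 - 2 / p))"
    by (intro mult_left_mono) auto
  finally show ?thesis .
next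
  case False
  \<comment> \<open>The p-norm bound \<open>L\<close> on \<open>x\<close> thereby becomes a bound
    \<open>L^2\<close> on the (p/2)-norm of the squares.\<close>
  have sq: "(y\<^sup>2) powr (p / 2) = y powr p" if "y \<ge> 0" for y :: real
  proof (cases "y = 0")
    case False
    then have "y\<^sup>2 = y powr 2" using that by (simp add: powr_numeral)
    then show ?thesis by (simp add: powr_powr)
  qed simp
  have "(\<Sum>j\<in>J. (x j)\<^sup>2) \<le> real n powr (1 - 1 / (p / 2)) * L\<^sup>2"
    by (rule power_mean) (use assms False sq in auto)
  also have "\<dots> \<le> L\<^sup>2 * (\<epsilon> powr (2 - p) + real n powr (1 - 2 / p))"
    by (simp add: mult.commute distrib_left)
  finally show ?thesis .
qed

text \<open>Markov's argument: every heavy coordinate contributes at least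
  \<open>(\<epsilon> * L) powr p\<close> to a sum of at most \<open>L powr p\<close>.\<close>

lemma card_heavy:
  fixes x :: "'a \<Rightarrow> real"
  assumes J: "finite J" and p: "p > 1" and L: "L > 0" and e: "\<epsilon> > 0"
    and heavy: "\<And>j. j \<in> J \<Longrightarrow> \<epsilon> * L \<le> x j"
    and le: "(\<Sum>j\<in>J. x j powr p) \<le> L powr p"
  shows "real (card J) \<le> \<epsilon> powr (- p)"
proof -
  have "real (card J) * (\<epsilon> * L) powr p = (\<Sum>j\<in>J. (\<epsilon> * L) powr p)" by simp
  also have "\<dots> \<le> (\<Sum>j\<in>J. x j powr p)"
    using heavy L e p by (intro sum_mono powr_mono2) auto
  also note le
  finally show ?thesis
    using L e by (simp add: powr_mult powr_minus field_simps)
qed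

section \<open>Failure probability of one hash function at one coordinate\<close>

text \<open>Heavy coordinates are handled by a union bound over collisions and light ones by
  Chebyshev. The coefficient 5 is 1 from the heavy part plus 4 from Chebyshev.\<close>

lemma hash_noise_tail:
  fixes x :: "nat \<Rightarrow> real"
  assumes i: "i < n" and B: "B > 0" and p: "p > 1" and L: "L > 0" and e: "\<epsilon> > 0"
    and x: "\<And>j. j < n \<Longrightarrow> 0 \<le> x j" and le: "(\<Sum>j<n. x j powr p) \<le> L powr p"
    and large: "2 * real n powr (1 - 1 / p) / \<epsilon> \<le> B"
  shows "real (card {h \<in> hash_functions n B. \<epsilon> * L < (\<Sum>j\<in>{..<n} - {i}. x j * of_bool (h j = h i))})
       \<le> real B ^ n * ((5 * \<epsilon> powr (- p) + 4 * real n powr (1 - 2 / p) / \<epsilon>\<^sup>2) / B)"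
proof -
  let ?F = "hash_functions n B"
  define H where "H = {j \<in> {..<n} - {i}. \<epsilon> * L < x j}"
  define J where "J = {j \<in> {..<n} - {i}. x j \<le> \<epsilon> * L}"
  have fin: "finite H" "finite J" by (auto simp: H_def J_def)
  have HJ: "{..<n} - {i} = H \<union> J" "H \<inter> J = {}" by (auto simp: H_def J_def)
  have sub: "H \<subseteq> {..<n}" "J \<subseteq> {..<n}" by (auto simp: H_def J_def)
  have cardJ: "card J \<le> n" using card_mono[OF _ sub(2)] by simp
  have leS: "(\<Sum>j\<in>S. x j powr p) \<le> L powr p" if "S \<subseteq> {..<n}" for S
    using sum_mono2[of "{..<n}" S "\<lambda>j. x j powr p"] that le by auto
  let ?T = "{h \<in> ?F. \<epsilon> * L < (\<Sum>j\<in>J. x j * of_bool (h j = h i))}"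
  let ?C = "\<lambda>j. {h \<in> ?F. h j = h i}"
  \<comment> \<open>If no heavy coordinate shares the bucket of \<open>i\<close>, all of the noise
    is light, so the light noise alone must exceed the threshold.\<close>
  have "{h \<in> ?F. \<epsilon> * L < (\<Sum>j\<in>{..<n} - {i}. x j * of_bool (h j = h i))} \<subseteq> ?T \<union> (\<Union>j\<in>H. ?C j)"
  proof (intro subsetI UnCI)
    fix h assume h: "h \<in> {h \<in> ?F. \<epsilon> * L < (\<Sum>j\<in>{..<n} - {i}. x j * of_bool (h j = h i))}"
      and nh: "h \<notin> (\<Union>j\<in>H. ?C j)"
    have "(\<Sum>j\<in>H. x j * of_bool (h j = h i)) = 0"
      using h nh by (intro sum.neutral) auto
    then have "(\<Sum>j\<in>{..<n} - {i}. x j * of_bool (h j = h i)) = (\<Sum>j\<in>J. x j * of_bool (h j = h i))"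
      unfolding HJ(1) by (subst sum.union_disjoint[OF fin HJ(2)]) linarith
    then show "h \<in> ?T" using h by auto
  qed
  then have "card {h \<in> ?F. \<epsilon> * L < (\<Sum>j\<in>{..<n} - {i}. x j * of_bool (h j = h i))}
      \<le> card (?T \<union> (\<Union>j\<in>H. ?C j))"
    using fin by (intro card_mono) auto
  also have "\<dots> \<le> card ?T + card (\<Union>j\<in>H. ?C j)" by (rule card_Un_le)
  also have "\<dots> \<le> card ?T + (\<Sum>j\<in>H. card (?C j))"
    using fin by (intro add_left_mono card_UN_le)
  finally have "real (card {h \<in> ?F. \<epsilon> * L < (\<Sum>j\<in>{..<n} - {i}. x j * of_bool (h j = h i))})
      \<le> real (card ?T) + (\<Sum>j\<in>H. real (card (?C j)))"
    by (simp flip: of_nat_sum of_nat_add)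
  moreover have "(\<Sum>j\<in>H. real (card (?C j))) \<le> real B ^ n * (\<epsilon> powr (- p) / B)"
  proof -
    have "(\<Sum>j\<in>H. real (card (?C j))) = (\<Sum>j\<in>H. real B ^ n / real B)"
      using i B by (intro sum.cong refl card_hash_collision) (auto simp: H_def)
    also have "\<dots> = real B ^ n / real B * real (card H)" by simp
    also have "\<dots> \<le> real B ^ n / real B * \<epsilon> powr (- p)"
      using card_heavy[OF fin(1) p L e _ leS[OF sub(1)]]
      by (intro mult_left_mono) (auto simp: H_def)
    finally show ?thesis by simp
  qed
  moreover have "real (card ?T) \<le> real B ^ n * ((4 * \<epsilon> powr (- p) + 4 * real n powr (1 - 2 / p) / \<epsilon>\<^sup>2) / B)"
  proof -
    have sq: "(\<Sum>j\<in>J. (x j)\<^sup>2) \<le> L\<^sup>2 * (\<epsilon> powr (2 - p) + real n powr (1 - 2 / p))"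
      by (rule sum_squares_truncated[OF fin(2) cardJ _ p L e _ _ leS[OF sub(2)]])
         (use i x in \<open>auto simp: J_def\<close>)
    have "real (card ?T) \<le> real B ^ n * (4 * (\<Sum>j\<in>J. (x j)\<^sup>2) / (B * (\<epsilon> * L)\<^sup>2))"
    proof (rule hash_chebyshev)
      \<comment> \<open>Hypothesis \<open>large\<close> is exactly what brings the mean of the light
        noise below half of the threshold.\<close>
      have "(\<Sum>j\<in>J. x j) \<le> real n powr (1 - 1 / p) * L"
        by (rule power_mean) (use fin cardJ i p L x sub leS in auto)
      also have "\<dots> \<le> (\<epsilon> * L / 2) * B"
        using large e L by (simp add: field_simps)
      finally show "(\<Sum>j\<in>J. x j) / B \<le> \<epsilon> * L / 2"
        using B by (simp add: field_simps)
    qed (use assms in \<open>auto simp: J_def\<close>)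
    also have "\<dots> \<le> real B ^ n * (4 * (L\<^sup>2 * (\<epsilon> powr (2 - p) + real n powr (1 - 2 / p))) / (B * (\<epsilon> * L)\<^sup>2))"
      by (intro mult_left_mono divide_right_mono sq) auto
    also have "4 * (L\<^sup>2 * (\<epsilon> powr (2 - p) + real n powr (1 - 2 / p))) / (B * (\<epsilon> * L)\<^sup>2)
        = (4 * \<epsilon> powr (- p) + 4 * real n powr (1 - 2 / p) / \<epsilon>\<^sup>2) / B"
    proof -
      \<comment> \<open>Dividing by the squared threshold turns the truncation term into
        \<open>\<epsilon> powr (- p)\<close>, the same order as the heavy term.\<close>
      have "\<epsilon> powr (2 - p) = \<epsilon>\<^sup>2 * \<epsilon> powr (- p)"
        using e by (simp add: powr_diff powr_minus_divide powr_numeral)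
      then show ?thesis using L e B by (simp add: field_simps power_mult_distrib)
    qed
    finally show ?thesis .
  qed
  ultimately have "real (card {h \<in> ?F. \<epsilon> * L < (\<Sum>j\<in>{..<n} - {i}. x j * of_bool (h j = h i))})
      \<le> real B ^ n * ((4 * \<epsilon> powr (- p) + 4 * real n powr (1 - 2 / p) / \<epsilon>\<^sup>2) / B)
        + real B ^ n * (\<epsilon> powr (- p) / B)"
    by linarith
  also have "\<dots> = real B ^ n * ((5 * \<epsilon> powr (- p) + 4 * real n powr (1 - 2 / p) / \<epsilon>\<^sup>2) / B)"
    by (simp flip: distrib_left add_divide_distrib)
  finally show ?thesis .
qed

text \<open>Both error terms are compared with \<open>Q = n powr (1 - 1 / p) / \<epsilon>\<close>,
  the order of \<open>B\<close>. The upper bound on \<open>1 / \<epsilon>\<close> makes each smaller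
  than \<open>Q\<close> by a power of \<open>n\<close>, and \<delta> is the lesser of the two
  exponents gained.\<close>

lemma hash_noise_tail_polynomial:
  fixes x :: "nat \<Rightarrow> real"
  assumes i: "i < n" and p: "p > 1" and c: "c > 0" and L: "L > 0" and e: "\<epsilon> > 0"
    and en: "1 / \<epsilon> \<le> real n powr ((1 - c) / p)"
    and x: "\<And>j. j < n \<Longrightarrow> 0 \<le> x j" and le: "(\<Sum>j<n. x j powr p) \<le> L powr p"
    and large: "10 * (1 / \<epsilon> * real n powr (1 - 1 / p)) \<le> B"
  shows "real (card {h \<in> hash_functions n B. \<epsilon> * L < (\<Sum>j\<in>{..<n} - {i}. x j * of_bool (h j = h i))})
       \<le> real B ^ n * real n powr (- (c * min (1 - 1 / p) (1 / p)))"
proof -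
  have n: "n > 0" using i by simp
  define Q where "Q = 1 / \<epsilon> * real n powr (1 - 1 / p)"
  define \<delta> where "\<delta> = c * min (1 - 1 / p) (1 / p)"
  have Q: "Q > 0" using n e by (simp add: Q_def)
  have "0 < real B" using Q large unfolding Q_def[symmetric] by linarith
  then have B: "B > 0" by simp
  have \<delta>: "\<delta> \<le> c * (1 - 1 / p)" "\<delta> \<le> c * (1 / p)"
    unfolding \<delta>_def using c by (intro mult_left_mono; simp)+
  have mono: "real n powr a \<le> real n powr b" if "a \<le> b" for a b
    using that n by (intro powr_mono) auto
  \<comment> \<open>One factor \<open>1 / \<epsilon>\<close> is kept for \<open>Q\<close>. Bounding
    the other \<open>p - 1\<close> powers by \<open>en\<close> saves \<open>c * (1 - 1 / p)\<close>
    in the exponent of \<open>n\<close>.\<close>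
  have heavy: "\<epsilon> powr (- p) \<le> Q * real n powr (- \<delta>)"
  proof -
    have "\<epsilon> powr (- p) = 1 / \<epsilon> * (1 / \<epsilon>) powr (p - 1)"
      using e by (simp add: powr_divide powr_diff powr_minus_divide)
    also have "(1 / \<epsilon>) powr (p - 1) \<le> (real n powr ((1 - c) / p)) powr (p - 1)"
      using e en p by (intro powr_mono2) auto
    also have "\<dots> = real n powr ((1 - 1 / p) - c * (1 - 1 / p))"
    proof -
      have "(1 - c) / p * (p - 1) = (1 - 1 / p) - c * (1 - 1 / p)"
        using p by (simp add: field_simps)
      then show ?thesis by (simp add: powr_powr)
    qed
    also have "\<dots> \<le> real n powr ((1 - 1 / p) - \<delta>)"
      using \<delta> by (intro mono) linarith
    finally show ?thesis
      using e by (simp add: Q_def powr_diff powr_minus_divide divide_right_mono)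
  qed
  \<comment> \<open>Of the two factors \<open>1 / \<epsilon>\<close> one is kept for
    \<open>Q\<close>; bounding the other by \<open>en\<close> saves \<open>c / p\<close> in the
    exponent.\<close>
  have light: "real n powr (1 - 2 / p) / \<epsilon>\<^sup>2 \<le> Q * real n powr (- \<delta>)"
  proof -
    have "real n powr (1 - 2 / p) * (1 / \<epsilon>) \<le> real n powr (1 - 2 / p) * real n powr ((1 - c) / p)"
      using en by (intro mult_left_mono) auto
    also have "\<dots> = real n powr ((1 - 1 / p) - c * (1 / p))"
    proof -
      have "1 - 2 / p + (1 - c) / p = (1 - 1 / p) - c * (1 / p)"
        using p by (simp add: field_simps)
      then show ?thesis by (metis powr_add)
    qed
    also have "\<dots> \<le> real n powr ((1 - 1 / p) - \<delta>)"
      using \<delta> by (intro mono) linarith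
    also have "\<dots> = real n powr (1 - 1 / p) * real n powr (- \<delta>)"
      by (simp flip: powr_add)
    finally have "real n powr (1 - 2 / p) * (1 / \<epsilon>) * (1 / \<epsilon>)
        \<le> real n powr (1 - 1 / p) * real n powr (- \<delta>) * (1 / \<epsilon>)"
      using e by (intro mult_right_mono) auto
    then show ?thesis by (simp add: Q_def power2_eq_square mult_ac)
  qed
  have "real (card {h \<in> hash_functions n B. \<epsilon> * L < (\<Sum>j\<in>{..<n} - {i}. x j * of_bool (h j = h i))})
       \<le> real B ^ n * ((5 * \<epsilon> powr (- p) + 4 * real n powr (1 - 2 / p) / \<epsilon>\<^sup>2) / B)"
    using large Q B unfolding Q_def[symmetric]
    by (intro hash_noise_tail[OF i _ p L e x le]) (auto simp: Q_def field_simps)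
  also have "\<dots> \<le> real B ^ n * ((B * real n powr (- \<delta>)) / B)"
  proof (intro mult_left_mono divide_right_mono)
    \<comment> \<open>The 10 in \<open>large\<close> covers 5 + 4 = 9 here; it also exceeds the 2
      that the mean bound in \<open>hash_noise_tail\<close> requires.\<close>
    have "5 * \<epsilon> powr (- p) + 4 * real n powr (1 - 2 / p) / \<epsilon>\<^sup>2 \<le> (10 * Q) * real n powr (- \<delta>)"
    proof -
      have "0 \<le> Q * real n powr (- \<delta>)" using Q by simp
      with heavy light show ?thesis unfolding mult.assoc times_divide_eq_right[symmetric] by linarith
    qed
    also have "\<dots> \<le> B * real n powr (- \<delta>)"
      using large unfolding Q_def[symmetric] by (intro mult_right_mono) auto
    finally show "5 * \<epsilon> powr (- p) + 4 * real n powr (1 - 2 / p) / \<epsilon>\<^sup>2 \<le> B * real n powr (- \<delta>)" .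
  qed auto
  also have "\<dots> = real B ^ n * real n powr (- \<delta>)" using B by simp
  finally show ?thesis by (simp add: \<delta>_def)
qed

lemma lp_norm_powr:
  assumes "p > 0"
  shows "lp_norm p x powr p = (\<Sum>i<dim_vec x. \<bar>x $ i\<bar> powr p)"
  using assms by (simp add: lp_norm_def powr_powr sum_nonneg)

lemma hash_noise_tail_lp_norm:
  assumes i: "i < n" and p: "p > 1" and c: "c > 0" and e: "\<epsilon> > 0"
    and en: "1 / \<epsilon> \<le> real n powr ((1 - c) / p)"
    and x: "x \<in> carrier_vec n" "\<And>j. j < n \<Longrightarrow> 0 \<le> x $ j"
    and large: "10 * (1 / \<epsilon> * real n powr (1 - 1 / p)) \<le> B"
  shows "real (card {h \<in> hash_functions n B.
            \<epsilon> * lp_norm p x < (\<Sum>j\<in>{..<n} - {i}. x $ j * of_bool (h j = h i))})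
       \<le> real B ^ n * real n powr (- (c * min (1 - 1 / p) (1 / p)))"
proof -
  have sum: "lp_norm p x powr p = (\<Sum>j<n. (x $ j) powr p)"
    using lp_norm_powr[of p x] p x by simp
  show ?thesis
  proof (cases "lp_norm p x = 0")
    \<comment> \<open>Norm 0 means that all coordinates vanish. The noise is then 0, and the strict
      inequality against the threshold 0 holds for no hash function.\<close>
    case True
    then have "(\<Sum>j<n. (x $ j) powr p) = 0" using sum p by simp
    then have "x $ j = 0" if "j < n" for j
      using that by (subst (asm) sum_nonneg_eq_0_iff) auto
    then have "(\<Sum>j\<in>{..<n} - {i}. x $ j * of_bool (h j = h i)) = 0" for h :: "nat \<Rightarrow> nat"
      by (intro sum.neutral) auto
    then show ?thesis using True by simp
  next
    case False
    then have "lp_norm p x > 0" by (simp add: lp_norm_def less_le)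
    then show ?thesis
      by (intro hash_noise_tail_polynomial) (use assms sum in auto)
  qed
qed

section \<open>The sketch matrix, the recovery procedure and the law\<close>

text \<open>Row \<open>r * B + b\<close> of the matrix computes bucket \<open>b\<close> of the \<open>r\<close>-th hash function.\<close>

definition sketch_matrix :: "nat \<Rightarrow> nat \<Rightarrow> nat \<Rightarrow> (nat \<Rightarrow> nat \<Rightarrow> nat) \<Rightarrow> real mat" where
  "sketch_matrix d n B h = mat (d * B) n (\<lambda>(t, j). of_bool (h (t div B) j = t mod B))"

text \<open>The minimum is unspecified if column \<open>i\<close> has no entry 1, which never happens for a sketch matrix
  with at least one hash function.\<close>

definition min_recovery :: "real mat \<Rightarrow> real vec \<Rightarrow> real vec" where
  "min_recovery A y = vec (dim_col A) (\<lambda>i. Min ((\<lambda>t. y $ t) ` {t. t < dim_row A \<and> A $$ (t, i) = 1}))"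

definition hash_tuples :: "nat \<Rightarrow> nat \<Rightarrow> nat \<Rightarrow> (nat \<Rightarrow> nat \<Rightarrow> nat) set" where
  "hash_tuples d n B = {..<d} \<rightarrow>\<^sub>E hash_functions n B"

text \<open>The space is the range of \<open>sketch_matrix\<close> with the discrete sigma-algebra.
  Every real function on it is measurable, and what is proved for each tuple of hash functions holds
  for every matrix in the space.\<close>

definition sketch_law :: "nat \<Rightarrow> nat \<Rightarrow> nat \<Rightarrow> real mat measure" where
  "sketch_law d n B = distr (uniform_count_measure (hash_tuples d n B))
     (count_space (sketch_matrix d n B ` hash_tuples d n B)) (sketch_matrix d n B)"

lemma finite_hash_tuples [simp]: "finite (hash_tuples d n B)"
  by (simp add: hash_tuples_def finite_PiE)

lemma card_hash_tuples: "card (hash_tuples d n B) = (B ^ n) ^ d"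
  by (simp add: hash_tuples_def card_PiE card_hash_functions)

lemma hash_tuples_nonempty: "B > 0 \<Longrightarrow> hash_tuples d n B \<noteq> {}"
  using card_hash_tuples[of d n B] by auto

lemma hash_tuples_less: "h \<in> hash_tuples d n B \<Longrightarrow> r < d \<Longrightarrow> i < n \<Longrightarrow> h r i < B"
  unfolding hash_tuples_def hash_functions_def by (drule PiE_mem, simp, drule PiE_mem) auto

text \<open>In column \<open>i\<close> the entries 1 sit exactly in the rows
  \<open>r * B + h r i\<close> with \<open>r < d\<close>. The matrix itself therefore reveals the
  buckets of \<open>i\<close>, and recovery needs no access to \<open>h\<close>.\<close>

lemma estimate_sketch_matrix:
  assumes h: "h \<in> hash_tuples d n B" and x: "x \<in> carrier_vec n" and i: "i < n"
  shows "estimate min_recovery (sketch_matrix d n B h) x $ i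
       = Min ((\<lambda>r. x $ i + (\<Sum>j\<in>{..<n} - {i}. x $ j * of_bool (h r j = h r i))) ` {..<d})"
proof -
  let ?A = "sketch_matrix d n B h"
  let ?S = "\<lambda>r. x $ i + (\<Sum>j\<in>{..<n} - {i}. x $ j * of_bool (h r j = h r i))"
  have row: "(?A *\<^sub>v x) $ t = ?S (t div B)" if t: "t < d * B" "h (t div B) i = t mod B" for t
  proof -
    have "(?A *\<^sub>v x) $ t = (\<Sum>j<n. of_bool (h (t div B) j = t mod B) * x $ j)"
      using t x by (simp add: sketch_matrix_def scalar_prod_def atLeast0LessThan)
    also have "\<dots> = ?S (t div B)"
      using i t by (subst sum.remove[of _ i]) (auto simp: mult.commute)
    finally show ?thesis .
  qed
  have entry: "t < dim_row ?A \<and> ?A $$ (t, i) = 1 \<longleftrightarrow> t < d * B \<and> h (t div B) i = t mod B" for t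
    using i by (auto simp: sketch_matrix_def)
  have "(\<lambda>t. (?A *\<^sub>v x) $ t) ` {t. t < d * B \<and> h (t div B) i = t mod B} = ?S ` {..<d}"
  proof (intro equalityI subsetI)
    fix y assume "y \<in> (\<lambda>t. (?A *\<^sub>v x) $ t) ` {t. t < d * B \<and> h (t div B) i = t mod B}"
    then obtain t where t: "t < d * B" "h (t div B) i = t mod B" "y = (?A *\<^sub>v x) $ t" by auto
    have "t div B \<in> {..<d}" using less_mult_imp_div_less[OF t(1)] by simp
    then show "y \<in> ?S ` {..<d}"
      unfolding t(3) row[OF t(1,2)] by (rule imageI)
  next
    fix y assume "y \<in> ?S ` {..<d}"
    then obtain r where r: "r < d" "y = ?S r" by auto
    \<comment> \<open>Since \<open>h r i < B\<close>, division with remainder by \<open>B\<close>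
      recovers \<open>r\<close> and \<open>h r i\<close> from this row index.\<close>
    define t where "t = r * B + h r i"
    have less: "h r i < B" using hash_tuples_less[OF h r(1) i] .
    have "t < (r + 1) * B" using less by (simp add: t_def)
    also have "\<dots> \<le> d * B" using r(1) by (intro mult_right_mono) auto
    finally have tl: "t < d * B" .
    have dm: "t div B = r" "t mod B = h r i" using less by (auto simp: t_def)
    then have "y = (?A *\<^sub>v x) $ t" using row[OF tl] r(2) by simp
    then show "y \<in> (\<lambda>t. (?A *\<^sub>v x) $ t) ` {t. t < d * B \<and> h (t div B) i = t mod B}"
      using tl dm by auto
  qed
  moreover have "estimate min_recovery ?A x $ i
      = Min ((\<lambda>t. (?A *\<^sub>v x) $ t) ` {t. t < d * B \<and> h (t div B) i = t mod B})"
  proof -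
    have "dim_col ?A = n" by (simp add: sketch_matrix_def)
    then show ?thesis using i by (simp only: estimate_def min_recovery_def index_vec entry)
  qed
  ultimately show ?thesis by (simp only:)
qed

section \<open>Guarantees of the sketch under its law\<close>

lemma space_sketch_law: "space (sketch_law d n B) = sketch_matrix d n B ` hash_tuples d n B"
  by (simp add: sketch_law_def)

text \<open>The event is pulled back along \<open>sketch_matrix\<close>, which reduces probabilities
  under the law to counts of tuples.\<close>

lemma measure_sketch_law:
  "measure (sketch_law d n B) {A \<in> space (sketch_law d n B). P A}
     = card {h \<in> hash_tuples d n B. P (sketch_matrix d n B h)} / card (hash_tuples d n B)"
proof -
  let ?U = "uniform_count_measure (hash_tuples d n B)"
  have "measure (sketch_law d n B) {A \<in> space (sketch_law d n B). P A}
      = measure ?U (sketch_matrix d n B -` {A \<in> space (sketch_law d n B). P A} \<inter> space ?U)"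
    unfolding sketch_law_def
    by (intro measure_distr) (auto simp: measurable_def sets_uniform_count_measure space_uniform_count_measure)
  also have "sketch_matrix d n B -` {A \<in> space (sketch_law d n B). P A} \<inter> space ?U
      = {h \<in> hash_tuples d n B. P (sketch_matrix d n B h)}"
    by (auto simp: space_sketch_law space_uniform_count_measure)
  finally show ?thesis by (simp add: measure_uniform_count_measure)
qed

lemma linear_sketch_sketch_law:
  assumes "B > 0"
  shows "linear_sketch (d * B) n (sketch_law d n B) min_recovery"
proof -
  interpret U: prob_space "uniform_count_measure (hash_tuples d n B)"
    using assms by (intro prob_space_uniform_count_measure hash_tuples_nonempty) auto
  have "prob_space (sketch_law d n B)"
    unfolding sketch_law_def
    by (intro U.prob_space_distr) (auto simp: measurable_def sets_uniform_count_measure space_uniform_count_measure)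
  moreover have "f \<in> borel_measurable (sketch_law d n B)" for f :: "real mat \<Rightarrow> real"
    by (simp add: sketch_law_def)
  ultimately show ?thesis
    by (auto simp: linear_sketch_def random_matrix_def space_sketch_law sketch_matrix_def min_recovery_def)
qed

text \<open>Each bucket of \<open>i\<close> holds \<open>x $ i\<close> plus nonnegative noise.
  Taking \<open>d > 0\<close> keeps the minimum over a nonempty set.\<close>

lemma le_estimate_sketch_matrix:
  assumes "h \<in> hash_tuples d n B" "x \<in> carrier_vec n" "\<And>j. j < n \<Longrightarrow> 0 \<le> x $ j" "i < n" "d > 0"
  shows "x $ i \<le> estimate min_recovery (sketch_matrix d n B h) x $ i"
  unfolding estimate_sketch_matrix[OF assms(1,2,4)]
  using assms by (intro Min.boundedI) (auto intro!: sum_nonneg)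

text \<open>A coordinate fails only if all \<open>d\<close> of its buckets do. Independence of the
  rows appears as the cardinality of a product set, and the union bound costs a factor
  \<open>n\<close> against \<open>1 / n^2\<close>.\<close>

lemma sketch_law_failure:
  assumes n: "n > 0" and d: "d > 0" and B: "B > 0" and x: "x \<in> carrier_vec n"
    and tail: "\<And>i. i < n \<Longrightarrow>
      real (card {h \<in> hash_functions n B. t < (\<Sum>j\<in>{..<n} - {i}. x $ j * of_bool (h j = h i))})
        \<le> real B ^ n * \<eta>"
    and small: "\<eta> ^ d \<le> 1 / (real n)\<^sup>2"
  shows "measure (sketch_law d n B) {A \<in> space (sketch_law d n B).
           \<forall>i<n. estimate min_recovery A x $ i \<le> x $ i + t} \<ge> 1 - 1 / real n"
proof -
  let ?H = "hash_tuples d n B"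
  let ?G = "{h \<in> ?H. \<forall>i<n. estimate min_recovery (sketch_matrix d n B h) x $ i \<le> x $ i + t}"
  let ?b = "\<lambda>i. {h \<in> hash_functions n B. t < (\<Sum>j\<in>{..<n} - {i}. x $ j * of_bool (h j = h i))}"
  \<comment> \<open>A minimum above the threshold forces every row into the bad set
    \<open>?b i\<close>, so the bad tuples for \<open>i\<close> lie in a d-fold product.\<close>
  have "?H - ?G \<subseteq> (\<Union>i<n. {..<d} \<rightarrow>\<^sub>E ?b i)"
  proof
    fix h assume h: "h \<in> ?H - ?G"
    then obtain i where i: "i < n" "x $ i + t < estimate min_recovery (sketch_matrix d n B h) x $ i"
      by force
    have "t < (\<Sum>j\<in>{..<n} - {i}. x $ j * of_bool (h r j = h r i))" if "r < d" for r
    proof -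
      have "h \<in> ?H" using h by blast
      note i(2)[unfolded estimate_sketch_matrix[OF this x i(1)]]
      also have "Min ((\<lambda>r. x $ i + (\<Sum>j\<in>{..<n} - {i}. x $ j * of_bool (h r j = h r i))) ` {..<d})
          \<le> x $ i + (\<Sum>j\<in>{..<n} - {i}. x $ j * of_bool (h r j = h r i))"
        using that by (intro Min_le imageI) auto
      finally show ?thesis by simp
    qed
    then have "h \<in> {..<d} \<rightarrow>\<^sub>E ?b i"
      using h by (auto simp: hash_tuples_def PiE_iff)
    then show "h \<in> (\<Union>i<n. {..<d} \<rightarrow>\<^sub>E ?b i)" using i by blast
  qed
  then have "card (?H - ?G) \<le> card (\<Union>i<n. {..<d} \<rightarrow>\<^sub>E ?b i)"
    by (intro card_mono) (auto intro!: finite_PiE)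
  also have "\<dots> \<le> (\<Sum>i<n. card ({..<d} \<rightarrow>\<^sub>E ?b i))" by (intro card_UN_le) simp
  also have "\<dots> = (\<Sum>i<n. card (?b i) ^ d)" by (simp add: card_PiE)
  finally have "real (card (?H - ?G)) \<le> (\<Sum>i<n. real (card (?b i)) ^ d)"
    by (simp flip: of_nat_power of_nat_sum)
  also have "\<dots> \<le> (\<Sum>i<n. (real B ^ n * \<eta>) ^ d)"
    using tail by (intro sum_mono power_mono) auto
  also have "\<dots> = real (card ?H) * (n * \<eta> ^ d)"
    by (simp add: card_hash_tuples power_mult_distrib)
  also have "\<dots> \<le> real (card ?H) * (n * (1 / (real n)\<^sup>2))"
    using small by (intro mult_left_mono) auto
  also have "\<dots> = real (card ?H) * (1 / n)" using n by (simp add: power2_eq_square)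
  finally have bad: "real (card (?H - ?G)) \<le> real (card ?H) * (1 / n)" .
  have "card (?H - ?G) = card ?H - card ?G" by (intro card_Diff_subset) auto
  moreover have "card ?G \<le> card ?H" by (intro card_mono) auto
  ultimately have "real (card ?G) = real (card ?H) - real (card (?H - ?G))" by simp
  also have "\<dots> \<ge> (1 - 1 / n) * real (card ?H)" using bad by (simp add: algebra_simps)
  finally have "(1 - 1 / n) * real (card ?H) \<le> real (card ?G)" .
  moreover have "real (card ?H) > 0" using B by (simp add: card_hash_tuples)
  ultimately show ?thesis
    unfolding measure_sketch_law by (simp add: pos_le_divide_eq)
qed

section \<open>Choice of the parameters and assembly\<close>

theorem mainTheorem6:
  fixes p c :: real
  assumes "1 < p" and "0 < c"
  shows "\<exists>C>0. \<forall>(n::nat) (\<epsilon>::real).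
    1 \<le> n \<and> 0 < \<epsilon> \<and> 1 \<le> 1 / \<epsilon> \<and> 1 / \<epsilon> \<le> real n powr ((1 - c) / p) \<longrightarrow>
    (\<exists>k M R.
       real k \<le> C * ((1 / \<epsilon>) * real n powr (1 - 1 / p)) \<and>
       linear_sketch k n M R \<and>
       (\<forall>x \<in> carrier_vec n. (\<forall>i<n. 0 \<le> x $ i) \<longrightarrow>
          (\<forall>A \<in> space M. \<forall>i<n. x $ i \<le> estimate R A x $ i) \<and>
          measure M {A \<in> space M. \<forall>i<n. estimate R A x $ i \<le> x $ i + \<epsilon> * lp_norm p x}
            \<ge> 1 - 1 / real n))"
proof -
  define \<delta> where "\<delta> = c * min (1 - 1 / p) (1 / p)"
  have \<delta>: "\<delta> > 0" using assms by (simp add: \<delta>_def)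
  \<comment> \<open>The number of rows depends only on \<open>p\<close> and \<open>c\<close>, and is
    chosen so that the d-th power of \<open>n powr - \<delta>\<close> is at most
    \<open>1 / n^2\<close>.\<close>
  define d where "d = nat \<lceil>2 / \<delta>\<rceil>"
  have d: "d > 0" using \<delta> by (simp add: d_def)
  have "2 / \<delta> \<le> d" unfolding d_def by (rule real_nat_ceiling_ge)
  then have d\<delta>: "2 \<le> \<delta> * d" using \<delta> by (simp add: field_simps)
  show ?thesis
  \<comment> \<open>There are \<open>d\<close> blocks of \<open>B\<close> rows each. Rounding
    \<open>10 * Q\<close> up gives \<open>B \<le> 10 * Q + 1 \<le> 11 * Q\<close>, as
    \<open>Q \<ge> 1\<close>.\<close>
  proof (intro exI[of _ "11 * real d"] conjI allI impI)
    fix n :: nat and \<epsilon> :: real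
    assume A: "1 \<le> n \<and> 0 < \<epsilon> \<and> 1 \<le> 1 / \<epsilon> \<and> 1 / \<epsilon> \<le> real n powr ((1 - c) / p)"
    then have n: "n > 0" and e: "\<epsilon> > 0" by auto
    define Q where "Q = 1 / \<epsilon> * real n powr (1 - 1 / p)"
    define B where "B = nat \<lceil>10 * Q\<rceil>"
    have "1 * 1 \<le> Q" unfolding Q_def
      using A assms by (intro mult_mono ge_one_powr_ge_zero) auto
    then have Q: "Q \<ge> 1" by simp
    have BQ: "10 * Q \<le> B" and BQ': "real B \<le> 11 * Q" using Q unfolding B_def by linarith+
    have B: "B > 0" using Q by (simp add: B_def)
    have "(real n powr - \<delta>) ^ d = real n powr (- (\<delta> * d))"
      using n by (simp add: powr_powr flip: powr_realpow)
    also have "\<dots> \<le> real n powr (- 2)" using n d\<delta> by (intro powr_mono) auto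
    also have "\<dots> = 1 / (real n)\<^sup>2" using n by (simp add: powr_minus_divide powr_numeral)
    finally have small: "(real n powr - \<delta>) ^ d \<le> 1 / (real n)\<^sup>2" .
    show "\<exists>k M R.
       real k \<le> 11 * real d * ((1 / \<epsilon>) * real n powr (1 - 1 / p)) \<and>
       linear_sketch k n M R \<and>
       (\<forall>x \<in> carrier_vec n. (\<forall>i<n. 0 \<le> x $ i) \<longrightarrow>
          (\<forall>A \<in> space M. \<forall>i<n. x $ i \<le> estimate R A x $ i) \<and>
          measure M {A \<in> space M. \<forall>i<n. estimate R A x $ i \<le> x $ i + \<epsilon> * lp_norm p x}
            \<ge> 1 - 1 / real n)"
    proof (intro exI conjI ballI impI)
      show "real (d * B) \<le> 11 * real d * ((1 / \<epsilon>) * real n powr (1 - 1 / p))"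
        using mult_left_mono[OF BQ', of "real d"] unfolding Q_def[symmetric] by (simp add: mult_ac)
      show "linear_sketch (d * B) n (sketch_law d n B) min_recovery"
        using B by (rule linear_sketch_sketch_law)
      fix x :: "real vec" assume x: "x \<in> carrier_vec n" "\<forall>i<n. 0 \<le> x $ i"
      show "\<forall>i<n. x $ i \<le> estimate min_recovery A x $ i" if "A \<in> space (sketch_law d n B)" for A
        using that x d le_estimate_sketch_matrix by (auto simp: space_sketch_law)
      show "measure (sketch_law d n B) {A \<in> space (sketch_law d n B).
          \<forall>i<n. estimate min_recovery A x $ i \<le> x $ i + \<epsilon> * lp_norm p x} \<ge> 1 - 1 / real n"
      proof (rule sketch_law_failure[OF n d B x(1) _ small])
        fix i assume "i < n"
        then show "real (card {h \<in> hash_functions n B.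
            \<epsilon> * lp_norm p x < (\<Sum>j\<in>{..<n} - {i}. x $ j * of_bool (h j = h i))})
          \<le> real B ^ n * real n powr - \<delta>"
          unfolding \<delta>_def using A assms x BQ
          by (intro hash_noise_tail_lp_norm) (auto simp: Q_def)
      qed
    qed
  qed (use d in simp)
qed

end
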